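(* Let $\tau\in\{12,\ 1\mbox{-}2,\ 21,\ 2\mbox{-}1\}$. For every $k\geq 2$, $$F_{\tau\mbox{-}3\mbox{-}4\mbox{-}\cdots\mbox{-}k}(x)=R_k(x),$$ where for $k=2$ the pattern is $\tau$ itself.
   Context: A generalized pattern is a permutation of $\{1,\dots,k\}$ written as a word $\tau_1\tau_2\cdots\tau_k$ in which each pair of adjacent letters may or may not be separated by a dash "-". A permutation $\pi=\pi_1\cdots\pi_n\in S_n$ contains $\tau$ if there are indices $i_1<\dots<i_k$ such that $(\pi_{i_1},\dots,\pi_{i_k})$ is order-isomorphic to $(\tau_1,\dots,\tau_k)$ and $i_{j+1}=i_j+1$ whenever $\tau_j$ and $\tau_{j+1}$ are not separated by a dash; otherwise $\pi$ avoids $\tau$. Thus $1\mbox{-}3\mbox{-}2$ is the classical pattern $132$. For a generalized pattern $\tau$, $F_\tau(x)=\sum_{n\geq0}f_\tau(n)x^n$, where $f_\tau(n)$ is the number of permutations in $S_n$ ($S_0$ consists of the empty permutation) avoiding both $1\mbox{-}3\mbox{-}2$ and $\tau$. $U_p$ is the Chebyshev polynomial of the second kind, $U_p(\cos\theta)=\sin((p+1)\theta)/\sin\theta$, and $R_p(x)=\dfrac{U_{p-1}\left(\frac{1}{2\sqrt{x}}\right)}{\sqrt{x}\,U_p\left(\frac{1}{2\sqrt{x}}\right)}$. *)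

theory Defs
  imports Complex_Main
    "HOL-Combinatorics.Multiset_Permutations"
    "HOL-Computational_Algebra.Formal_Laurent_Series"
    "HOL-Computational_Algebra.Polynomial"
begin

text \<open>
  A generalized pattern is a pair of a word (a permutation of 1..k, as a list) and a list of
  k - 1 flags; entry j of the second list (counting from 0) is True iff there is a dash between
  the adjacent letters at positions j and j + 1.
\<close>

type_synonym gpattern = "nat list \<times> bool list"

definition pat_contains :: "nat list \<Rightarrow> gpattern \<Rightarrow> bool" where
  "pat_contains \<pi> \<tau> \<longleftrightarrow>
     (\<exists>is :: nat list. length is = length (fst \<tau>) \<and> sorted_wrt (<) is \<and>
        (\<forall>i\<in>set is. i < length \<pi>) \<and>
        (\<forall>a<length (fst \<tau>). \<forall>b<length (fst \<tau>).
            \<pi> ! (is ! a) < \<pi> ! (is ! b) \<longleftrightarrow> fst \<tau> ! a < fst \<tau> ! b) \<and>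
        (\<forall>j. Suc j < length (fst \<tau>) \<and> \<not> snd \<tau> ! j \<longrightarrow> is ! Suc j = Suc (is ! j)))"

abbreviation pat_avoids :: "nat list \<Rightarrow> gpattern \<Rightarrow> bool" where
  "pat_avoids \<pi> \<tau> \<equiv> \<not> pat_contains \<pi> \<tau>"

definition pat_132 :: gpattern where
  "pat_132 = ([1, 3, 2], [True, True])"

text \<open>The pattern \<open>\<tau>-3-4-\<dots>-k\<close> for a pattern \<open>\<tau>\<close> on two letters.\<close>

definition extend_pat :: "gpattern \<Rightarrow> nat \<Rightarrow> gpattern" where
  "extend_pat \<tau> k = (fst \<tau> @ [3..<Suc k], snd \<tau> @ replicate (k - 2) True)"

definition f_count :: "gpattern \<Rightarrow> nat \<Rightarrow> nat" where
  "f_count \<tau> n =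
     card {\<pi> \<in> permutations_of_set {1..n}. pat_avoids \<pi> pat_132 \<and> pat_avoids \<pi> \<tau>}"

definition F_gf :: "gpattern \<Rightarrow> real fps" where
  "F_gf \<tau> = Abs_fps (\<lambda>n. real (f_count \<tau> n))"

definition chebyshev_U :: "nat \<Rightarrow> real poly" where
  "chebyshev_U p =
     (THE P. \<forall>\<theta>. sin \<theta> \<noteq> 0 \<longrightarrow> poly P (cos \<theta>) = sin (real (p + 1) * \<theta>) / sin \<theta>)"

lemma chebyshev_U_unique:
  fixes P Q :: "real poly"
  assumes P: "\<forall>\<theta>. sin \<theta> \<noteq> 0 \<longrightarrow> poly P (cos \<theta>) = g \<theta>"
    and Q: "\<forall>\<theta>. sin \<theta> \<noteq> 0 \<longrightarrow> poly Q (cos \<theta>) = g \<theta>"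
  shows "P = Q"
proof (rule ccontr)
  assume "P \<noteq> Q"
  then have "finite {x. poly (P - Q) x = 0}"
    by (intro poly_roots_finite) simp
  moreover have "{-1<..<1} \<subseteq> {x. poly (P - Q) x = 0}"
  proof
    fix x :: real assume x: "x \<in> {-1<..<1}"
    then have "cos (arccos x) = x" "sin (arccos x) \<noteq> 0"
      using sin_arccos_nonzero[of x] by (auto simp: cos_arccos)
    with P Q show "x \<in> {x. poly (P - Q) x = 0}"
      by (metis (mono_tags) mem_Collect_eq poly_diff right_minus_eq)
  qed
  ultimately have "finite {-1<..<(1::real)}"
    by (rule finite_subset[rotated])
  then show False
    by (simp add: infinite_Ioo)
qed

lemma chebyshev_U_ex:
  "\<exists>P :: real poly. \<forall>\<theta>. sin \<theta> \<noteq> 0 \<longrightarrow> poly P (cos \<theta>) = sin (real (p + 1) * \<theta>) / sin \<theta>"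
proof (induction p rule: induct_nat_012)
  case 0
  show ?case by (intro exI[of _ 1]) simp
next
  case 1
  have "sin (real (Suc 0 + 1) * \<theta>) = 2 * sin \<theta> * cos \<theta>" for \<theta> :: real
    using sin_double[of \<theta>] by simp
  then show ?case
    by (intro exI[of _ "[:0, 2:]"]) (simp add: field_simps)
next
  case (ge2 n)
  from ge2 obtain P Q :: "real poly" where
    P: "\<And>\<theta>. sin \<theta> \<noteq> 0 \<Longrightarrow> poly P (cos \<theta>) = sin (real (n + 1) * \<theta>) / sin \<theta>" and
    Q: "\<And>\<theta>. sin \<theta> \<noteq> 0 \<Longrightarrow> poly Q (cos \<theta>) = sin (real (Suc n + 1) * \<theta>) / sin \<theta>"
    by blast
  have rec: "sin (real (Suc (Suc n) + 1) * \<theta>)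
      = 2 * cos \<theta> * sin (real (Suc n + 1) * \<theta>) - sin (real (n + 1) * \<theta>)" for \<theta> :: real
  proof -
    have "sin (real (Suc (Suc n) + 1) * \<theta>) = sin (real (Suc n + 1) * \<theta> + \<theta>)"
      by (simp add: algebra_simps)
    moreover have "sin (real (n + 1) * \<theta>) = sin (real (Suc n + 1) * \<theta> - \<theta>)"
      by (simp add: algebra_simps)
    ultimately show ?thesis
      unfolding sin_add sin_diff by simp
  qed
  show ?case
  proof (intro exI allI impI)
    fix \<theta> :: real assume "sin \<theta> \<noteq> 0"
    then show "poly ([:0, 2:] * Q - P) (cos \<theta>) = sin (real (Suc (Suc n) + 1) * \<theta>) / sin \<theta>"
      unfolding rec poly_diff poly_mult P[OF \<open>sin \<theta> \<noteq> 0\<close>] Q[OF \<open>sin \<theta> \<noteq> 0\<close>]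
      by (simp add: diff_divide_distrib)
  qed
qed

lemma chebyshev_U:
  assumes "sin \<theta> \<noteq> 0"
  shows "poly (chebyshev_U p) (cos \<theta>) = sin (real (p + 1) * \<theta>) / sin \<theta>"
proof -
  have "\<exists>!P :: real poly. \<forall>\<theta>. sin \<theta> \<noteq> 0 \<longrightarrow>
      poly P (cos \<theta>) = sin (real (p + 1) * \<theta>) / sin \<theta>"
    using chebyshev_U_ex[of p]
      chebyshev_U_unique[where g = "\<lambda>\<theta>. sin (real (p + 1) * \<theta>) / sin \<theta>"]
    by (intro ex_ex1I) blast+
  from theI'[OF this] show ?thesis
    using assms unfolding chebyshev_U_def by blast
qed

text \<open>
  \<open>R_sqrt p\<close> is $R_p(x)$ read as a formal Laurent series in the indeterminate $t = \sqrt{x}$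
  (for $p \geq 1$). Since $x = t^2$, a power series $F(x)$ equals $R_p(x)$ iff $F(t^2)$ equals
  \<open>R_sqrt p\<close>.
\<close>

definition U_at :: "nat \<Rightarrow> real fls \<Rightarrow> real fls" where
  "U_at p y = poly (map_poly fls_const (chebyshev_U p)) y"

definition R_sqrt :: "nat \<Rightarrow> real fls" where
  "R_sqrt p = U_at (p - 1) (1 / (2 * fls_X)) / (fls_X * U_at p (1 / (2 * fls_X)))"

end

theory Submission imports Defs begin

text \<open>
  A nonempty permutation avoiding 1-3-2 is \<open>\<alpha> n \<beta>\<close> with \<open>n\<close> the maximum and every letter
  of \<open>\<alpha>\<close> larger than every letter of \<open>\<beta>\<close>. Since the last letter of \<open>\<tau>-3-\<dots>-(k+1)\<close> is
  its maximum, no occurrence can straddle \<open>\<alpha>\<close> and \<open>\<beta>\<close>: the permutation contains this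
  pattern iff \<open>\<alpha>\<close> contains \<open>\<tau>-3-\<dots>-k\<close> or \<open>\<beta>\<close> contains the full pattern. Hence
  $F_{k+1} = 1 + x F_k F_{k+1}$, which is also the recurrence that the three-term recurrence of
  the Chebyshev polynomials gives for $R_k$. For \<open>k = 2\<close> only the monotone
  permutation avoids \<open>\<tau>\<close>, so $F_2 = 1/(1-x) = R_2$.
\<close>

section \<open>Pattern containment\<close>

text \<open>Exposes the index list hidden by the existential in \<open>pat_contains\<close>, so that
  one occurrence can be translated, shortened or prolonged.\<close>

definition pat_occ :: "nat list \<Rightarrow> gpattern \<Rightarrow> nat list \<Rightarrow> bool" where
  "pat_occ \<pi> \<tau> ks \<longleftrightarrow> length ks = length (fst \<tau>) \<and> sorted_wrt (<) ks \<and>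
        (\<forall>i\<in>set ks. i < length \<pi>) \<and>
        (\<forall>a<length (fst \<tau>). \<forall>b<length (fst \<tau>).
            \<pi> ! (ks ! a) < \<pi> ! (ks ! b) \<longleftrightarrow> fst \<tau> ! a < fst \<tau> ! b) \<and>
        (\<forall>j. Suc j < length (fst \<tau>) \<and> \<not> snd \<tau> ! j \<longrightarrow> ks ! Suc j = Suc (ks ! j))"

lemma pat_contains_iff_occ: "pat_contains \<pi> \<tau> \<longleftrightarrow> (\<exists>ks. pat_occ \<pi> \<tau> ks)"
  by (simp add: pat_contains_def pat_occ_def)

text \<open>Adding \<open>length xs\<close> to all indices keeps their order and keeps neighbours
  adjacent. The factor has to be contiguous, since inserting letters in its middle could separate
  two letters that the pattern wants adjacent.\<close>

lemma pat_contains_infix: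
  assumes "pat_contains ys \<tau>"
  shows "pat_contains (xs @ ys @ zs) \<tau>"
proof -
  obtain js where js: "pat_occ ys \<tau> js"
    using assms by (auto simp: pat_contains_iff_occ)
  have nth: "(xs @ ys @ zs) ! (map ((+) (length xs)) js ! a) = ys ! (js ! a)"
    if "a < length js" for a
    using js that by (auto simp: pat_occ_def nth_append)
  have "pat_occ (xs @ ys @ zs) \<tau> (map ((+) (length xs)) js)"
    using js nth unfolding pat_occ_def
    by (auto simp: sorted_wrt_map)
  then show ?thesis
    by (auto simp: pat_contains_iff_occ)
qed

text \<open>Undoes the translation. The range condition makes the natural-number subtraction exact,
  so order and adjacency of the indices survive.\<close>

lemma pat_occ_infixD:
  assumes occ: "pat_occ (xs @ ys @ zs) \<tau> ks"
    and range: "\<And>i. i \<in> set ks \<Longrightarrow> length xs \<le> i \<and> i < length xs + length ys"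
  shows "pat_contains ys \<tau>"
proof -
  define js where "js = map (\<lambda>i. i - length xs) ks"
  have nth: "ys ! (js ! a) = (xs @ ys @ zs) ! (ks ! a)" if "a < length ks" for a
    using range[of "ks ! a"] that by (auto simp: js_def nth_append)
  have "sorted_wrt (<) js"
    using occ range unfolding js_def sorted_wrt_map pat_occ_def
    by (auto elim!: sorted_wrt_mono_rel[rotated] simp: diff_less_mono)
  moreover have "js ! Suc j = Suc (js ! j)"
    if "Suc j < length ks" "ks ! Suc j = Suc (ks ! j)" for j
    using that range[of "ks ! j"] by (auto simp: js_def Suc_diff_le)
  moreover have "\<forall>i\<in>set js. i < length ys"
    using range by (fastforce simp: js_def)
  moreover have "length js = length ks" by (simp add: js_def)
  ultimately have "pat_occ ys \<tau> js"
    using occ nth unfolding pat_occ_def by auto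
  then show ?thesis
    by (auto simp: pat_contains_iff_occ)
qed

text \<open>The letters enter \<open>pat_occ\<close> only through comparisons, so the same index
  list works on both sides.\<close>

lemma pat_contains_map:
  assumes "strict_mono_on (set \<pi>) f"
  shows "pat_contains (map f \<pi>) \<tau> \<longleftrightarrow> pat_contains \<pi> \<tau>"
proof -
  have *: "f (\<pi> ! i) < f (\<pi> ! j) \<longleftrightarrow> \<pi> ! i < \<pi> ! j" if "i < length \<pi>" "j < length \<pi>" for i j
    using strict_mono_on_less[OF assms] that by simp
  have "pat_occ (map f \<pi>) \<tau> ks \<longleftrightarrow> pat_occ \<pi> \<tau> ks" for ks
    unfolding pat_occ_def using * by (auto simp: nth_mem cong: conj_cong)
  then show ?thesis
    by (simp add: pat_contains_iff_occ)
qed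

section \<open>Splitting a word at its maximum\<close>

text \<open>Let \<open>L\<close> be the position playing \<open>M\<close>. If it lies in \<alpha> or
  at \<open>m\<close>, all earlier indices lie in \<alpha> and form \<open>(w, d)\<close>. If it
  lies in \<beta>, all letters used are smaller than or equal to a letter of \<beta>, so they avoid
  \<alpha> and \<open>m\<close>. Conversely \<open>m\<close> completes any copy of
  \<open>(w, d)\<close> in \<alpha>; the dash before \<open>M\<close> permits the gap. By
  \<open>len\<close>, the appended flag sits exactly between \<open>w\<close> and
  \<open>M\<close>.\<close>

lemma pat_contains_snoc_max_iff:
  assumes \<alpha>: "\<forall>x\<in>set \<alpha>. x < m" and \<beta>: "\<forall>y\<in>set \<beta>. y < m"
    and \<alpha>\<beta>: "\<forall>x\<in>set \<alpha>. \<forall>y\<in>set \<beta>. y < x"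
    and w: "\<forall>x\<in>set w. x < M" and len: "length w = Suc (length d)"
  shows "pat_contains (\<alpha> @ m # \<beta>) (w @ [M], d @ [True]) \<longleftrightarrow>
    pat_contains \<alpha> (w, d) \<or> pat_contains \<beta> (w @ [M], d @ [True])"
proof (intro iffI; (elim disjE)?)
  let ?\<pi> = "\<alpha> @ m # \<beta>" and ?l = "length w"
  assume "pat_contains ?\<pi> (w @ [M], d @ [True])"
  then obtain js where js: "pat_occ ?\<pi> (w @ [M], d @ [True]) js"
    by (auto simp: pat_contains_iff_occ)
  obtain ks L where isL: "js = ks @ [L]"
    using js by (cases js rule: rev_cases) (auto simp: pat_occ_def)
  have len_is: "length ks = ?l" and less_L: "\<forall>i\<in>set ks. i < L" and L: "L < length ?\<pi>"
    using js by (auto simp: pat_occ_def isL sorted_wrt_append)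
  have ord: "?\<pi> ! (js ! a) < ?\<pi> ! (js ! b) \<longleftrightarrow> (w @ [M]) ! a < (w @ [M]) ! b"
    if "a < Suc ?l" "b < Suc ?l" for a b
    using js that by (simp add: pat_occ_def)
  have val: "?\<pi> ! i < ?\<pi> ! L" if i: "i \<in> set ks" for i
  proof -
    obtain a where a: "a < ?l" "i = ks ! a"
      using i len_is by (auto simp: in_set_conv_nth)
    have "(w @ [M]) ! a < (w @ [M]) ! ?l"
      using w a by (simp add: nth_append)
    then show ?thesis
      using ord[of a ?l] a len_is by (simp add: isL nth_append)
  qed
  have adj: "ks ! Suc j = Suc (ks ! j)" if "Suc j < ?l" "\<not> d ! j" for j
  proof -
    have "\<forall>j. Suc j < length (w @ [M]) \<and> \<not> (d @ [True]) ! j \<longrightarrow> js ! Suc j = Suc (js ! j)"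
      using js by (simp add: pat_occ_def)
    from this[rule_format, of j] show ?thesis
      using that len len_is by (simp add: isL nth_append)
  qed
  have "pat_occ ?\<pi> (w, d) ks"
    unfolding pat_occ_def
  proof (intro conjI allI impI)
    show "sorted_wrt (<) ks"
      using js by (simp add: pat_occ_def isL sorted_wrt_append)
    show "\<forall>i\<in>set ks. i < length ?\<pi>"
      using less_L L by auto
    show "?\<pi> ! (ks ! a) < ?\<pi> ! (ks ! b) \<longleftrightarrow> fst (w, d) ! a < fst (w, d) ! b"
      if "a < length (fst (w, d))" "b < length (fst (w, d))" for a b
    proof -
      have "js ! c = ks ! c" "(w @ [M]) ! c = w ! c" if "c < ?l" for c
        using that by (simp_all add: isL nth_append len_is)
      then show ?thesis
        using ord[of a b] that by simp
    qed
  qed (use adj len_is in auto)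
  then have occ: "pat_occ ([] @ \<alpha> @ (m # \<beta>)) (w, d) ks" by simp
  show "pat_contains \<alpha> (w, d) \<or> pat_contains \<beta> (w @ [M], d @ [True])"
  \<comment> \<open>Equality is the case where \<open>m\<close> itself plays \<open>M\<close>; the
    indices in \<open>ks\<close> are below \<open>length \<alpha>\<close> there too.\<close>
  proof (cases "L \<le> length \<alpha>")
    case True
    then have "pat_contains \<alpha> (w, d)"
      using less_L by (intro pat_occ_infixD[OF occ]) auto
    then show ?thesis ..
  next
    case False
    then have "?\<pi> ! L \<in> set \<beta>"
      using L by (auto simp: nth_append nth_Cons')
    have "length \<alpha> < i" if "i \<in> set ks" for i
    proof (rule ccontr)
      assume "\<not> length \<alpha> < i"
      then have "?\<pi> ! i \<in> insert m (set \<alpha>)"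
        by (auto simp: nth_append nth_Cons')
      with \<open>?\<pi> ! L \<in> set \<beta>\<close> have "?\<pi> ! L < ?\<pi> ! i"
        using \<alpha>\<beta> \<beta> by auto
      with val[OF that] show False by simp
    qed
    then have "pat_contains \<beta> (w @ [M], d @ [True])"
      using False L less_L js
      by (intro pat_occ_infixD[of "\<alpha> @ [m]" \<beta> "[]" _ js]) (auto simp: isL Suc_le_eq)
    then show ?thesis ..
  qed
next
  assume "pat_contains \<beta> (w @ [M], d @ [True])"
  from pat_contains_infix[OF this, of "\<alpha> @ [m]" "[]"]
  show "pat_contains (\<alpha> @ m # \<beta>) (w @ [M], d @ [True])" by simp
next
  let ?\<pi> = "\<alpha> @ m # \<beta>" and ?l = "length w"
  assume "pat_contains \<alpha> (w, d)"
  then obtain ks where occ: "pat_occ \<alpha> (w, d) ks"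
    by (auto simp: pat_contains_iff_occ)
  then have len_is: "length ks = ?l" and rng: "\<And>a. a < ?l \<Longrightarrow> ks ! a < length \<alpha>"
    by (auto simp: pat_occ_def)
  have ord: "\<alpha> ! (ks ! a) < \<alpha> ! (ks ! b) \<longleftrightarrow> w ! a < w ! b" if "a < ?l" "b < ?l" for a b
    using occ that by (simp add: pat_occ_def)
  have adj: "ks ! Suc j = Suc (ks ! j)" if "Suc j < ?l" "\<not> d ! j" for j
    using occ that by (simp add: pat_occ_def)
  have "pat_occ ?\<pi> (w @ [M], d @ [True]) (ks @ [length \<alpha>])"
    unfolding pat_occ_def
  proof (intro conjI allI impI)
    show "sorted_wrt (<) (ks @ [length \<alpha>])"
      using occ by (simp add: pat_occ_def sorted_wrt_append)
    show "\<forall>i\<in>set (ks @ [length \<alpha>]). i < length ?\<pi>"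
      using occ by (auto simp: pat_occ_def)
    show "?\<pi> ! ((ks @ [length \<alpha>]) ! a) < ?\<pi> ! ((ks @ [length \<alpha>]) ! b) \<longleftrightarrow>
        fst (w @ [M], d @ [True]) ! a < fst (w @ [M], d @ [True]) ! b"
      if "a < length (fst (w @ [M], d @ [True]))" "b < length (fst (w @ [M], d @ [True]))" for a b
    proof -
      have v: "w ! a < M" "\<alpha> ! (ks ! a) < m" if "a < ?l" for a
        using that w \<alpha> rng by simp_all
      show ?thesis
        using that v[of a] v[of b] ord[of a b] rng[of a] rng[of b]
        by (auto simp: nth_append len_is less_Suc_eq not_less)
    qed
    show "(ks @ [length \<alpha>]) ! Suc j = Suc ((ks @ [length \<alpha>]) ! j)"
      if "Suc j < length (fst (w @ [M], d @ [True])) \<and> \<not> snd (w @ [M], d @ [True]) ! j" for j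
      using that adj[of j] len len_is by (auto simp: nth_append less_Suc_eq split: if_splits)
  qed (use len_is in simp)
  then show "pat_contains ?\<pi> (w @ [M], d @ [True])"
    by (auto simp: pat_contains_iff_occ)
qed

text \<open>Both flags are dashes, so adjacency imposes nothing, and the chain of two inequalities
  determines every comparison among the three letters.\<close>

lemma pat_contains_132_iff:
  "pat_contains \<pi> pat_132 \<longleftrightarrow>
    (\<exists>i j l. i < j \<and> j < l \<and> l < length \<pi> \<and> \<pi> ! i < \<pi> ! l \<and> \<pi> ! l < \<pi> ! j)"
proof
  assume "pat_contains \<pi> pat_132"
  then obtain ks where occ: "pat_occ \<pi> pat_132 ks"
    by (auto simp: pat_contains_iff_occ)
  then have "length ks = 3"
    by (simp add: pat_occ_def pat_132_def)
  then obtain i j l where ks: "ks = [i, j, l]"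
    by (auto simp: numeral_3_eq_3 length_Suc_conv)
  have "\<pi> ! (ks ! a) < \<pi> ! (ks ! b) \<longleftrightarrow> [1, 3, 2::nat] ! a < [1, 3, 2] ! b"
    if "a < 3" "b < 3" for a b
    using occ that by (simp add: pat_occ_def pat_132_def)
  from this[of 0 2] this[of 2 1] occ
  show "\<exists>i j l. i < j \<and> j < l \<and> l < length \<pi> \<and> \<pi> ! i < \<pi> ! l \<and> \<pi> ! l < \<pi> ! j"
    by (intro exI[of _ i] exI[of _ j] exI[of _ l]) (auto simp: ks pat_occ_def)
next
  assume "\<exists>i j l. i < j \<and> j < l \<and> l < length \<pi> \<and> \<pi> ! i < \<pi> ! l \<and> \<pi> ! l < \<pi> ! j"
  then obtain i j l where "i < j" "j < l" "l < length \<pi>" "\<pi> ! i < \<pi> ! l" "\<pi> ! l < \<pi> ! j"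
    by blast
  then have "pat_occ \<pi> pat_132 [i, j, l]"
    by (auto simp: pat_occ_def pat_132_def less_Suc_eq numeral_3_eq_3)
  then show "pat_contains \<pi> pat_132"
    by (auto simp: pat_contains_iff_occ)
qed

text \<open>The last letter of 1-3-2 is not its maximum, so this needs its own argument. The letter
  playing 2 is not \<open>m\<close>, as a larger one precedes it. If it is in \<alpha>, so is the
  whole occurrence; if it is in \<beta>, the smaller letter playing 1 must be in \<beta>, and the
  rest follows it.\<close>

lemma pat_contains_132_max_iff:
  assumes \<alpha>: "\<forall>x\<in>set \<alpha>. x < m" and \<beta>: "\<forall>y\<in>set \<beta>. y < m"
    and \<alpha>\<beta>: "\<forall>x\<in>set \<alpha>. \<forall>y\<in>set \<beta>. y < x"
  shows "pat_contains (\<alpha> @ m # \<beta>) pat_132 \<longleftrightarrow>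
    pat_contains \<alpha> pat_132 \<or> pat_contains \<beta> pat_132"
proof
  let ?\<pi> = "\<alpha> @ m # \<beta>"
  assume "pat_contains ?\<pi> pat_132"
  then obtain i j l where h: "i < j" "j < l" "l < length ?\<pi>" "?\<pi> ! i < ?\<pi> ! l" "?\<pi> ! l < ?\<pi> ! j"
    unfolding pat_contains_132_iff by blast
  have le: "x \<in> set ?\<pi> \<Longrightarrow> x \<le> m" for x
    using \<alpha> \<beta> by auto
  have "?\<pi> ! j \<le> m"
    using h by (intro le nth_mem) auto
  then have "l \<noteq> length \<alpha>"
    using h(5) by (auto simp: nth_append)
  then consider "l < length \<alpha>" | "length \<alpha> < l" by linarith
  then show "pat_contains \<alpha> pat_132 \<or> pat_contains \<beta> pat_132"
  proof cases
    case 1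
    then have "pat_contains \<alpha> pat_132"
      unfolding pat_contains_132_iff using h
      by (intro exI[of _ i] exI[of _ j] exI[of _ l]) (auto simp: nth_append)
    then show ?thesis ..
  next
    case 2
    then have "?\<pi> ! l \<in> set \<beta>"
      using h by (auto simp: nth_append nth_Cons')
    have "length \<alpha> < i"
    proof (rule ccontr)
      assume "\<not> length \<alpha> < i"
      then have "?\<pi> ! i \<in> insert m (set \<alpha>)"
        by (auto simp: nth_append nth_Cons')
      with \<open>?\<pi> ! l \<in> set \<beta>\<close> have "?\<pi> ! l < ?\<pi> ! i"
        using \<alpha>\<beta> \<beta> by auto
      with h show False by simp
    qed
    then obtain i' j' l' where
      "i = Suc (length \<alpha> + i')" "j = Suc (length \<alpha> + j')" "l = Suc (length \<alpha> + l')"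
      using h by (metis less_iff_Suc_add less_trans)
    then have "pat_contains \<beta> pat_132"
      unfolding pat_contains_132_iff using h
      by (intro exI[of _ i'] exI[of _ j'] exI[of _ l']) (auto simp: nth_append)
    then show ?thesis ..
  qed
next
  assume "pat_contains \<alpha> pat_132 \<or> pat_contains \<beta> pat_132"
  then show "pat_contains (\<alpha> @ m # \<beta>) pat_132"
    using pat_contains_infix[of \<alpha> pat_132 "[]" "m # \<beta>"]
      pat_contains_infix[of \<beta> pat_132 "\<alpha> @ [m]" "[]"] by auto
qed

text \<open>Otherwise distinctness gives \<open>x < y\<close>, and \<open>x\<close>,
  \<open>m\<close>, \<open>y\<close> form an occurrence of 1-3-2.\<close>

lemma avoids_132_max_split:
  assumes "pat_avoids (\<alpha> @ m # \<beta>) pat_132" and "distinct (\<alpha> @ m # \<beta>)"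
    and "\<forall>y\<in>set \<beta>. y < m" and x: "x \<in> set \<alpha>" and y: "y \<in> set \<beta>"
  shows "y < x"
proof (rule ccontr)
  assume "\<not> y < x"
  with assms have "x < y" "y < m"
    by (auto simp: not_less le_less)
  obtain i l where il: "i < length \<alpha>" "\<alpha> ! i = x" "l < length \<beta>" "\<beta> ! l = y"
    using x y by (auto simp: in_set_conv_nth)
  have "pat_contains (\<alpha> @ m # \<beta>) pat_132"
    unfolding pat_contains_132_iff using il \<open>x < y\<close> \<open>y < m\<close>
    by (intro exI[of _ i] exI[of _ "length \<alpha>"] exI[of _ "Suc (length \<alpha> + l)"])
      (auto simp: nth_append)
  with assms show False by simp
qed

section \<open>Counting\<close>

text \<open>The ground set is arbitrary because the prefix before the maximum is a permutation of an
  upper interval rather than of an initial segment.\<close>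

definition avoiders :: "gpattern \<Rightarrow> nat set \<Rightarrow> nat list set" where
  "avoiders \<tau> A = {\<pi> \<in> permutations_of_set A. pat_avoids \<pi> pat_132 \<and> pat_avoids \<pi> \<tau>}"

lemma f_count_eq_card_avoiders: "f_count \<tau> n = card (avoiders \<tau> {1..n})"
  by (simp add: f_count_def avoiders_def)

lemma finite_avoiders: "finite (avoiders \<tau> A)"
  by (simp add: avoiders_def)

lemma f_count_shift: "card (avoiders \<tau> {Suc c..c + n}) = f_count \<tau> n"
proof -
  have mono: "strict_mono_on B ((+) c)" for B
    by (auto intro: strict_mono_onI)
  have shift: "{Suc c..c + n} = (+) c ` {1..n}"
    by (simp add: image_add_atLeastAtMost)
  have "permutations_of_set {Suc c..c + n} = map ((+) c) ` permutations_of_set {1..n}"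
    unfolding shift by (rule permutations_of_set_image_inj) simp
  then have "avoiders \<tau> {Suc c..c + n} = map ((+) c) ` avoiders \<tau> {1..n}"
    by (auto simp: avoiders_def pat_contains_map[OF mono])
  then show ?thesis
    by (simp add: f_count_eq_card_avoiders card_image inj_on_subset[of _ UNIV])
qed

text \<open>\<open>B\<close> is downward closed in \<open>{1..n}\<close>: a smaller number lying in
  \<open>A\<close> would have to exceed all of \<open>B\<close>. Hence \<open>B\<close> ends at
  \<open>Max B\<close>, which equals its cardinality.\<close>

lemma initial_segment_split:
  fixes A B :: "nat set"
  assumes "A \<union> B = {1..n}" and gt: "\<forall>x\<in>A. \<forall>y\<in>B. y < x"
  shows "B = {1..card B}" and "A = {Suc (card B)..n}"
proof -
  have fin: "finite B"
    using assms(1) by (metis finite_Un finite_atLeastAtMost)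
  show B: "B = {1..card B}"
  proof (cases "B = {}")
    case False
    then have "Max B \<in> B" using fin by simp
    have "B = {1..Max B}"
    proof (intro equalityI subsetI)
      show "x \<in> {1..Max B}" if "x \<in> B" for x
        using that fin assms(1) by (auto dest: equalityD1)
      fix x assume x: "x \<in> {1..Max B}"
      then have "x \<in> A \<union> B"
        using \<open>Max B \<in> B\<close> assms(1) by (metis UnCI atLeastAtMost_iff le_trans)
      then show "x \<in> B"
        using gt \<open>Max B \<in> B\<close> x by (auto simp: not_le[symmetric])
    qed
    then show ?thesis
      by (metis card_atLeastAtMost diff_Suc_1)
  qed simp
  have "A \<inter> B = {}" using gt by blast
  then have "A = {1..n} - {1..card B}"
    using assms(1) B by blast
  then show "A = {Suc (card B)..n}" by auto
qed

text \<open>The index \<open>i\<close> is the length of \<alpha>. Since \<alpha> lies above \<beta>,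
  this length fixes both ground sets. The prefix avoids the shorter pattern because the maximum
  would complete it.\<close>

lemma avoiders_snoc_max_eq:
  assumes w: "\<forall>x\<in>set w. x < M" and len: "length w = Suc (length d)"
  shows "avoiders (w @ [M], d @ [True]) {1..Suc n} =
    (\<lambda>(_, \<alpha>, \<beta>). \<alpha> @ Suc n # \<beta>) `
      (SIGMA i:{..n}. avoiders (w, d) {Suc (n - i)..n} \<times>
        avoiders (w @ [M], d @ [True]) {1..n - i})"
    (is "?L = ?f ` ?S")
proof (intro equalityI subsetI)
  fix \<pi> assume "\<pi> \<in> ?L"
  then have \<pi>: "set \<pi> = {1..Suc n}" "distinct \<pi>" "pat_avoids \<pi> pat_132"
      "pat_avoids \<pi> (w @ [M], d @ [True])"
    by (auto simp: avoiders_def permutations_of_set_def)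
  then have "Suc n \<in> set \<pi>" by simp
  then obtain \<alpha> \<beta> where split: "\<pi> = \<alpha> @ Suc n # \<beta>"
    by (auto dest: split_list)
  have un: "set \<alpha> \<union> set \<beta> = {1..n}"
  proof -
    have "set \<alpha> \<union> set \<beta> = set \<pi> - {Suc n}"
      using \<pi>(2) by (auto simp: split)
    also have "\<dots> = {1..n}"
      unfolding \<pi>(1) by auto
    finally show ?thesis .
  qed
  then have lt: "\<forall>x\<in>set \<alpha>. x < Suc n" "\<forall>x\<in>set \<beta>. x < Suc n"
    by (auto simp: less_Suc_eq_le dest: equalityD1)
  have gt: "\<forall>x\<in>set \<alpha>. \<forall>y\<in>set \<beta>. y < x"
    using avoids_132_max_split[of \<alpha> "Suc n" \<beta>] \<pi> lt by (auto simp: split)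
  note seg = initial_segment_split[OF un gt]
  have card_\<beta>: "card (set \<beta>) = length \<beta>" and "card (set \<alpha>) = length \<alpha>"
    using \<pi>(2) by (auto simp: split distinct_card)
  moreover have "length \<pi> = Suc n"
    using distinct_card[OF \<pi>(2)] \<pi>(1) by simp
  ultimately have i: "length \<alpha> \<le> n" "card (set \<beta>) = n - length \<alpha>"
    by (auto simp: split)
  have "(length \<alpha>, \<alpha>, \<beta>) \<in> ?S"
    using \<pi> i seg unfolding split
      pat_contains_132_max_iff[OF lt gt] pat_contains_snoc_max_iff[OF lt gt w len]
    by (auto simp: avoiders_def permutations_of_set_def)
  then show "\<pi> \<in> ?f ` ?S"
    by (intro image_eqI[of _ _ "(length \<alpha>, \<alpha>, \<beta>)"]) (auto simp: split)
next
  fix \<pi> assume "\<pi> \<in> ?f ` ?S"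
  then obtain i \<alpha> \<beta> where i: "i \<le> n" and split: "\<pi> = \<alpha> @ Suc n # \<beta>"
    and "\<alpha> \<in> avoiders (w, d) {Suc (n - i)..n}"
    and "\<beta> \<in> avoiders (w @ [M], d @ [True]) {1..n - i}"
    by auto
  then have \<alpha>: "set \<alpha> = {Suc (n - i)..n}" "distinct \<alpha>" "pat_avoids \<alpha> pat_132"
      "pat_avoids \<alpha> (w, d)"
    and \<beta>: "set \<beta> = {1..n - i}" "distinct \<beta>" "pat_avoids \<beta> pat_132"
      "pat_avoids \<beta> (w @ [M], d @ [True])"
    by (auto simp: avoiders_def permutations_of_set_def)
  have lt: "\<forall>x\<in>set \<alpha>. x < Suc n" "\<forall>x\<in>set \<beta>. x < Suc n"
    and gt: "\<forall>x\<in>set \<alpha>. \<forall>y\<in>set \<beta>. y < x"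
    using \<alpha> \<beta> by auto
  show "\<pi> \<in> ?L"
    using \<alpha> \<beta> i unfolding split avoiders_def mem_Collect_eq
      pat_contains_132_max_iff[OF lt gt] pat_contains_snoc_max_iff[OF lt gt w len]
    by (auto simp: permutations_of_set_def)
qed

text \<open>Counts the splittings by the number \<open>i\<close> of letters before the maximum,
  after checking that each permutation arises from one triple only.\<close>

lemma f_count_snoc_max_Suc:
  assumes "\<forall>x\<in>set w. x < M" and "length w = Suc (length d)"
  shows "f_count (w @ [M], d @ [True]) (Suc n) =
    (\<Sum>i\<le>n. f_count (w, d) i * f_count (w @ [M], d @ [True]) (n - i))"
proof -
  let ?S = "SIGMA i:{..n}. avoiders (w, d) {Suc (n - i)..n} \<times>
    avoiders (w @ [M], d @ [True]) {1..n - i}"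
  have "inj_on (\<lambda>(_, \<alpha>, \<beta>). \<alpha> @ Suc n # \<beta>) ?S"
  proof (rule inj_onI)
    fix p q
    assume pq: "p \<in> ?S" "q \<in> ?S"
      and f: "(\<lambda>(_, \<alpha>, \<beta>). \<alpha> @ Suc n # \<beta>) p = (\<lambda>(_, \<alpha>, \<beta>). \<alpha> @ Suc n # \<beta>) q"
    obtain i \<alpha> \<beta> i' \<alpha>' \<beta>' where p: "p = (i, \<alpha>, \<beta>)" and q: "q = (i', \<alpha>', \<beta>')"
      by (metis prod_cases3)
    have eq: "\<alpha> @ Suc n # \<beta> = \<alpha>' @ Suc n # \<beta>'"
      using f by (simp add: p q)
    have *: "set \<alpha> = {Suc (n - i)..n}" "set \<alpha>' = {Suc (n - i')..n}" "set \<beta> = {1..n - i}"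
      and i: "i \<le> n" "i' \<le> n"
      using pq by (auto simp: p q avoiders_def permutations_of_set_def)
    \<comment> \<open>\<open>Suc n\<close> occurs in neither \<alpha> nor \<beta>, so the place
      where the word is cut is unique.\<close>
    then have "\<alpha> = \<alpha>' \<and> \<beta> = \<beta>'"
      using eq by (subst (asm) append_Cons_eq_iff) auto
    \<comment> \<open>For \<open>i \<le> n\<close> the interval of letters of \<alpha> has exactly
      \<open>i\<close> elements.\<close>
    moreover from this have "i = i'"
      using * i arg_cong[of "{Suc (n - i)..n}" "{Suc (n - i')..n}" card] by auto
    ultimately show "p = q" by (simp add: p q)
  qed
  then have "f_count (w @ [M], d @ [True]) (Suc n) = card ?S"
    unfolding f_count_eq_card_avoiders avoiders_snoc_max_eq[OF assms] by (rule card_image)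
  also have "\<dots> = (\<Sum>i\<le>n. card (avoiders (w, d) {Suc (n - i)..n}) *
      f_count (w @ [M], d @ [True]) (n - i))"
    by (simp add: card_SigmaI finite_avoiders card_cartesian_product f_count_eq_card_avoiders)
  also have "\<dots> = (\<Sum>i\<le>n. f_count (w, d) i * f_count (w @ [M], d @ [True]) (n - i))"
    using f_count_shift[of "(w, d)" "n - i" i for i]
    by (intro sum.cong refl) (metis atMost_iff le_add_diff_inverse2)
  finally show ?thesis .
qed

section \<open>Generating functions and the recurrence in \<open>k\<close>\<close>

text \<open>The empty permutation has no positions, so it can contain only a pattern with no
  letters.\<close>

lemma f_count_0:
  assumes "fst \<tau> \<noteq> []"
  shows "f_count \<tau> 0 = 1"
proof -
  have "{\<pi> \<in> permutations_of_set {1..0}. pat_avoids \<pi> pat_132 \<and> pat_avoids \<pi> \<tau>} = {[]}"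
    using assms by (auto simp: pat_contains_def pat_132_def)
  then show ?thesis by (simp add: f_count_def)
qed

text \<open>The 1 counts the empty permutation, \<open>fps_X\<close> marks the maximum, and the
  convolution becomes a product.\<close>

lemma F_gf_snoc_max:
  assumes "\<forall>x\<in>set w. x < M" and "length w = Suc (length d)"
  shows "F_gf (w @ [M], d @ [True]) =
    1 + fps_X * F_gf (w, d) * F_gf (w @ [M], d @ [True])"
proof (rule fps_ext)
  fix n
  show "F_gf (w @ [M], d @ [True]) $ n =
    (1 + fps_X * F_gf (w, d) * F_gf (w @ [M], d @ [True])) $ n"
  proof (cases n)
    case 0
    then show ?thesis by (simp add: F_gf_def f_count_0)
  next
    case (Suc m)
    have "(1 + fps_X * F_gf (w, d) * F_gf (w @ [M], d @ [True])) $ n =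
        (F_gf (w, d) * F_gf (w @ [M], d @ [True])) $ m"
      by (simp add: Suc mult.assoc)
    also have "\<dots> = F_gf (w @ [M], d @ [True]) $ n"
      by (simp add: Suc F_gf_def fps_mult_nth atLeast0AtMost f_count_snoc_max_Suc[OF assms])
    finally show ?thesis ..
  qed
qed

lemma extend_pat_Suc:
  assumes "k \<ge> 2"
  shows "extend_pat \<tau> (Suc k) = (fst (extend_pat \<tau> k) @ [Suc k], snd (extend_pat \<tau> k) @ [True])"
proof -
  obtain j where "k = Suc (Suc j)"
    using assms by (metis One_nat_def Suc_1 Suc_le_D Suc_le_mono)
  then show ?thesis by (simp add: extend_pat_def replicate_append_same)
qed

text \<open>The conditions on \<tau> ensure that all letters of \<open>extend_pat \<tau> k\<close>
  are below \<open>Suc k\<close> and that it has one flag fewer than letters.\<close>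

lemma F_gf_extend_pat_Suc:
  assumes "set (fst \<tau>) = {1, 2}" "length (fst \<tau>) = 2" "length (snd \<tau>) = 1" "k \<ge> 2"
  shows "F_gf (extend_pat \<tau> (Suc k)) =
    1 + fps_X * F_gf (extend_pat \<tau> k) * F_gf (extend_pat \<tau> (Suc k))"
  using F_gf_snoc_max[of "fst (extend_pat \<tau> k)" "Suc k" "snd (extend_pat \<tau> k)"] assms
  unfolding extend_pat_Suc[OF assms(4)] by (auto simp: extend_pat_def)

section \<open>Patterns on two letters\<close>

lemma pat_contains_two_iff:
  assumes ab: "a \<noteq> b"
  shows "pat_contains \<pi> ([a, b], [dash]) \<longleftrightarrow>
    (\<exists>i j. i < j \<and> j < length \<pi> \<and> (dash \<or> j = Suc i) \<and> \<pi> ! i \<noteq> \<pi> ! j \<and>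
      (\<pi> ! i < \<pi> ! j \<longleftrightarrow> a < b))"
proof
  assume "pat_contains \<pi> ([a, b], [dash])"
  then obtain ks where occ: "pat_occ \<pi> ([a, b], [dash]) ks"
    by (auto simp: pat_contains_iff_occ)
  then have "length ks = Suc (Suc 0)"
    by (simp add: pat_occ_def)
  then obtain i j where ks: "ks = [i, j]"
    by (auto simp: length_Suc_conv)
  have "\<pi> ! (ks ! x) < \<pi> ! (ks ! y) \<longleftrightarrow> [a, b] ! x < [a, b] ! y" if "x < 2" "y < 2" for x y
    using occ that by (simp add: pat_occ_def)
  from this[of 0 1] this[of 1 0] occ ab
  show "\<exists>i j. i < j \<and> j < length \<pi> \<and> (dash \<or> j = Suc i) \<and> \<pi> ! i \<noteq> \<pi> ! j \<and>
    (\<pi> ! i < \<pi> ! j \<longleftrightarrow> a < b)"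
    by (intro exI[of _ i] exI[of _ j]) (auto simp: ks pat_occ_def)
next
  assume "\<exists>i j. i < j \<and> j < length \<pi> \<and> (dash \<or> j = Suc i) \<and> \<pi> ! i \<noteq> \<pi> ! j \<and>
    (\<pi> ! i < \<pi> ! j \<longleftrightarrow> a < b)"
  then obtain i j where "i < j" "j < length \<pi>" "dash \<or> j = Suc i" "\<pi> ! i \<noteq> \<pi> ! j"
    "\<pi> ! i < \<pi> ! j \<longleftrightarrow> a < b" by blast
  then have "pat_occ \<pi> ([a, b], [dash]) [i, j]"
    using ab by (auto simp: pat_occ_def less_Suc_eq)
  then show "pat_contains \<pi> ([a, b], [dash])"
    by (auto simp: pat_contains_iff_occ)
qed

text \<open>By transitivity, being monotone at adjacent positions is the same as being monotone
  throughout, so both values of \<open>dash\<close> give the same condition.\<close>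

lemma contains_two_iff_not_sorted:
  assumes "distinct \<pi>"
  shows "pat_contains \<pi> ([1, 2], [dash]) \<longleftrightarrow> \<not> sorted_wrt (>) \<pi>"
    and "pat_contains \<pi> ([2, 1], [dash]) \<longleftrightarrow> \<not> sorted_wrt (<) \<pi>"
proof -
  have ne: "\<pi> ! i \<noteq> \<pi> ! j" if "i < j" "j < length \<pi>" for i j
    using assms that by (simp add: nth_eq_iff_index_eq)
  have "transp ((>) :: nat \<Rightarrow> _)" "transp ((<) :: nat \<Rightarrow> _)"
    by (auto intro: transpI)
  note adj = this[THEN sorted_wrt_iff_nth_Suc_transp]
  have "pat_avoids \<pi> ([1, 2], [dash]) \<longleftrightarrow>
      (\<forall>i j. i < j \<and> j < length \<pi> \<and> (dash \<or> j = Suc i) \<longrightarrow> \<pi> ! j < \<pi> ! i)"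
    using ne by (subst pat_contains_two_iff)
      (simp, simp, metis linorder_neqE_nat not_less_iff_gr_or_eq)
  also have "\<dots> \<longleftrightarrow> sorted_wrt (>) \<pi>"
    by (cases dash) (simp add: sorted_wrt_iff_nth_less, auto simp: adj)
  finally show "pat_contains \<pi> ([1, 2], [dash]) \<longleftrightarrow> \<not> sorted_wrt (>) \<pi>"
    by blast
  have "pat_avoids \<pi> ([2, 1], [dash]) \<longleftrightarrow>
      (\<forall>i j. i < j \<and> j < length \<pi> \<and> (dash \<or> j = Suc i) \<longrightarrow> \<pi> ! i < \<pi> ! j)"
    using ne by (subst pat_contains_two_iff)
      (simp, simp, metis linorder_neqE_nat not_less_iff_gr_or_eq)
  also have "\<dots> \<longleftrightarrow> sorted_wrt (<) \<pi>"
    by (cases dash) (simp add: sorted_wrt_iff_nth_less, auto simp: adj)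
  finally show "pat_contains \<pi> ([2, 1], [dash]) \<longleftrightarrow> \<not> sorted_wrt (<) \<pi>"
    by blast
qed

lemma f_count_two:
  assumes "w \<in> {[1, 2], [2, 1]}"
  shows "f_count (w, [dash]) n = 1"
proof -
  let ?up = "[1..<Suc n]"
  have avoid_132: "pat_avoids \<pi> pat_132" if "sorted_wrt (<) \<pi> \<or> sorted_wrt (>) \<pi>" for \<pi>
  proof
    assume "pat_contains \<pi> pat_132"
    then obtain i j l where "i < j" "j < l" "l < length \<pi>" "\<pi> ! i < \<pi> ! l" "\<pi> ! l < \<pi> ! j"
      unfolding pat_contains_132_iff by blast
    moreover from this have "i < l" by simp
    \<comment> \<open>Positions \<open>j\<close>, \<open>l\<close> carry a descent and
      \<open>i\<close>, \<open>l\<close> an ascent, so the word is not monotone in either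
      direction.\<close>
    ultimately show False
      using that sorted_wrt_nth_less[of "(<)" \<pi> j l] sorted_wrt_nth_less[of "(>)" \<pi> i l] by auto
  qed
  have up: "\<pi> = ?up" if "sorted_wrt (<) \<pi>" "set \<pi> = {1..n}" for \<pi>
    by (rule strict_sorted_equal)
      (use that in \<open>simp_all add: atLeastLessThanSuc_atLeastAtMost del: upt_Suc\<close>)
  have down: "\<pi> = rev ?up" if "sorted_wrt (>) \<pi>" "set \<pi> = {1..n}" for \<pi>
    using up[of "rev \<pi>"] that by (auto simp: sorted_wrt_rev rev_swap)
  consider "w = [1, 2]" | "w = [2, 1]" using assms by blast
  then show ?thesis
  proof cases
    case 1
    have "sorted_wrt (>) (rev ?up)"
      unfolding sorted_wrt_rev by (rule sorted_wrt_upt)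
    then have "avoiders (w, [dash]) {1..n} = {rev ?up}"
      using down avoid_132[of "rev ?up"]
      by (auto simp: avoiders_def permutations_of_set_def
          contains_two_iff_not_sorted[unfolded One_nat_def] 1 simp del: upt_Suc)
    then show ?thesis unfolding f_count_eq_card_avoiders by simp
  next
    case 2
    have "avoiders (w, [dash]) {1..n} = {?up}"
      using up avoid_132[of ?up]
      by (auto simp: avoiders_def permutations_of_set_def contains_two_iff_not_sorted[unfolded One_nat_def]
          2 simp del: upt_Suc)
    then show ?thesis unfolding f_count_eq_card_avoiders by simp
  qed
qed

section \<open>Chebyshev polynomials at $1/(2t)$\<close>

text \<open>\<open>cheb_fps p\<close> is the power series $t^p U_p(1/(2t))$.\<close>

fun cheb_fps :: "nat \<Rightarrow> real fps" where
  "cheb_fps 0 = 1"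
| "cheb_fps (Suc 0) = 1"
| "cheb_fps (Suc (Suc p)) = cheb_fps (Suc p) - fps_X ^ 2 * cheb_fps p"

text \<open>The subtracted term starts in degree 2 or higher. The constant term 1 later justifies
  dividing by this series.\<close>

lemma cheb_fps_nth_0: "cheb_fps p $ 0 = 1"
  by (induction p rule: cheb_fps.induct) (simp_all add: power2_eq_square mult.assoc)

lemma chebyshev_U_eqI:
  assumes "\<And>\<theta>. sin \<theta> \<noteq> 0 \<Longrightarrow> poly P (cos \<theta>) = sin (real (p + 1) * \<theta>) / sin \<theta>"
  shows "chebyshev_U p = P"
  by (rule chebyshev_U_unique[where g = "\<lambda>\<theta>. sin (real (p + 1) * \<theta>) / sin \<theta>"])
    (use assms chebyshev_U in blast)+

lemma chebyshev_U_0: "chebyshev_U 0 = 1"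
  by (rule chebyshev_U_eqI) simp

lemma chebyshev_U_1: "chebyshev_U (Suc 0) = [:0, 2:]"
  using sin_double[where 'a = real] by (intro chebyshev_U_eqI) (simp add: field_simps)

text \<open>This is \<open>sin (a + \<theta>) + sin (a - \<theta>) = 2 * cos \<theta> * sin
  a\<close> with \<open>a = (p + 2) * \<theta>\<close>.\<close>

lemma chebyshev_U_Suc_Suc:
  "chebyshev_U (Suc (Suc p)) = [:0, 2:] * chebyshev_U (Suc p) - chebyshev_U p"
proof (rule chebyshev_U_eqI)
  fix \<theta> :: real assume nz: "sin \<theta> \<noteq> 0"
  have "sin (real (Suc (Suc p) + 1) * \<theta>) = sin (real (Suc p + 1) * \<theta> + \<theta>)"
    and "sin (real (p + 1) * \<theta>) = sin (real (Suc p + 1) * \<theta> - \<theta>)"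
    by (simp_all add: algebra_simps)
  then have "sin (real (Suc (Suc p) + 1) * \<theta>)
      = 2 * cos \<theta> * sin (real (Suc p + 1) * \<theta>) - sin (real (p + 1) * \<theta>)"
    unfolding sin_add sin_diff by simp
  then show "poly ([:0, 2:] * chebyshev_U (Suc p) - chebyshev_U p) (cos \<theta>) =
      sin (real (Suc (Suc p) + 1) * \<theta>) / sin \<theta>"
    unfolding poly_diff poly_mult chebyshev_U[OF nz] by (simp add: diff_divide_distrib)
qed

text \<open>With the next lemma, carries the three-term recurrence over to Laurent
  coefficients.\<close>

lemma map_poly_fls_const_diff:
  "map_poly fls_const (p - q) = map_poly fls_const p - map_poly fls_const (q :: real poly)"
  by (rule poly_eqI) (simp add: coeff_map_poly fls_minus_const)

lemma map_poly_fls_const_two_X_mult: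
  "map_poly fls_const ([:0, 2:] * p) = [:0, 2:] * map_poly fls_const (p :: real poly)"
  by (rule poly_eqI)
    (simp add: coeff_map_poly coeff_pCons fls_const_mult_const[symmetric] split: nat.split)

lemma U_at_0: "U_at 0 y = 1"
  by (simp add: U_at_def chebyshev_U_0)

lemma U_at_1: "U_at (Suc 0) y = 2 * y"
  using map_poly_fls_const_two_X_mult[of 1] by (simp add: U_at_def chebyshev_U_1)

lemma U_at_Suc_Suc: "U_at (Suc (Suc p)) y = 2 * y * U_at (Suc p) y - U_at p y"
  unfolding U_at_def chebyshev_U_Suc_Suc map_poly_fls_const_diff map_poly_fls_const_two_X_mult
  by simp

text \<open>In the recurrence multiplied by \<open>fls_X ^ (p + 2)\<close>, one factor cancels
  \<open>2 * y\<close> and two remain on the subtracted term, which gives the recurrence of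
  \<open>cheb_fps\<close>.\<close>

lemma U_at_half_inverse_X: "fls_X ^ p * U_at p (1 / (2 * fls_X)) = fps_to_fls (cheb_fps p)"
proof -
  define y :: "real fls" where "y = 1 / (2 * fls_X)"
  have "fls_X * (2 * y) = (2 * fls_X) / (2 * fls_X)"
    by (simp only: y_def times_divide_eq_right mult_1_right mult.commute[of fls_X 2])
  also have "\<dots> = 1"
    by (rule divide_self) simp
  finally have y: "fls_X * (2 * y) = 1" .
  have "fls_X ^ p * U_at p y = fps_to_fls (cheb_fps p)"
  proof (induction p rule: cheb_fps.induct)
    case (3 p)
    have "fls_X ^ Suc (Suc p) * U_at (Suc (Suc p)) y =
      (fls_X * (2 * y)) * (fls_X ^ Suc p * U_at (Suc p) y) - fls_X ^ 2 * (fls_X ^ p * U_at p y)"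
      by (simp add: U_at_Suc_Suc algebra_simps power2_eq_square)
    also have "\<dots> = fps_to_fls (cheb_fps (Suc p)) - fls_X ^ 2 * fps_to_fls (cheb_fps p)"
      unfolding y "3.IH" by simp
    finally show ?case
      by (simp add: fls_times_fps_to_fls fps_to_fls_power)
  qed (simp_all add: U_at_0 U_at_1 y)
  then show ?thesis by (simp only: y_def)
qed

text \<open>Expand the fraction by \<open>fls_X ^ (p - 1)\<close>; the extra \<open>fls_X\<close> in
  the denominator supplies its missing power.\<close>

lemma R_sqrt_eq:
  assumes "p \<ge> 1"
  shows "R_sqrt p = fps_to_fls (cheb_fps (p - 1)) / fps_to_fls (cheb_fps p)"
proof -
  obtain q where p: "p = Suc q" using assms by (cases p) auto
  show ?thesis
    unfolding U_at_half_inverse_X[symmetric] R_sqrt_def p by simp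
qed

section \<open>Identification with the Chebyshev quotient\<close>

text \<open>Writing \<open>G k\<close> for the composed series and \<open>c k\<close> for
  \<open>cheb_fps k\<close>, the step is \<open>G (k+1) * (c k - t^2 * c (k-1)) = G (k+1) * (1 - t^2
  * G k) * c k = c k\<close>. The product form avoids division of power series.\<close>

lemma F_gf_compose_mult_cheb_fps:
  assumes "\<tau> \<in> {([1, 2], [False]), ([1, 2], [True]), ([2, 1], [False]), ([2, 1], [True])}"
    and "k \<ge> 2"
  shows "(F_gf (extend_pat \<tau> k) oo fps_X ^ 2) * cheb_fps k = cheb_fps (k - 1)"
  using assms(2)
proof (induction k rule: dec_induct)
  case base
  \<comment> \<open>Exactly one permutation of each length is counted, so this is the geometric
    series.\<close>
  have "F_gf (extend_pat \<tau> 2) = Abs_fps (\<lambda>_. 1)"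
    using assms(1) by (auto simp: F_gf_def extend_pat_def f_count_two)
  then have "F_gf (extend_pat \<tau> 2) * (1 - fps_X) = 1"
    by (simp add: fps_eq_iff algebra_simps)
  then have "(F_gf (extend_pat \<tau> 2) * (1 - fps_X)) oo fps_X ^ 2 = 1"
    by simp
  then show ?case
    by (simp add: fps_compose_mult_distrib fps_compose_sub_distrib numeral_2_eq_2)
next
  case (step k)
  let ?G = "\<lambda>k. F_gf (extend_pat \<tau> k) oo fps_X ^ 2"
  have "F_gf (extend_pat \<tau> (Suc k)) =
      1 + fps_X * F_gf (extend_pat \<tau> k) * F_gf (extend_pat \<tau> (Suc k))"
    using assms(1) step by (intro F_gf_extend_pat_Suc) auto
  then have "?G (Suc k) = (1 + fps_X * F_gf (extend_pat \<tau> k) * F_gf (extend_pat \<tau> (Suc k)))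
      oo fps_X ^ 2"
    by (rule arg_cong)
  then have G: "?G (Suc k) = 1 + fps_X ^ 2 * ?G k * ?G (Suc k)"
    by (simp add: fps_compose_mult_distrib fps_compose_add_distrib)
  obtain j where k: "k = Suc j" using step by (cases k) auto
  have "?G (Suc k) * cheb_fps (Suc k) =
      ?G (Suc k) * cheb_fps k - fps_X ^ 2 * ?G (Suc k) * cheb_fps (k - 1)"
    by (simp add: k algebra_simps)
  \<comment> \<open>The induction hypothesis turns \<open>cheb_fps (k - 1)\<close> into a multiple
    of \<open>cheb_fps k\<close>.\<close>
  also have "\<dots> = (?G (Suc k) - fps_X ^ 2 * ?G k * ?G (Suc k)) * cheb_fps k"
    unfolding step.IH[symmetric] by (simp add: algebra_simps)
  also have "?G (Suc k) - fps_X ^ 2 * ?G k * ?G (Suc k) = 1"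
    using G by (simp add: algebra_simps)
  finally show ?case by simp
qed

theorem theorem2p3:
  fixes \<tau> :: gpattern and k :: nat
  assumes "\<tau> \<in> {([1, 2], [False]), ([1, 2], [True]), ([2, 1], [False]), ([2, 1], [True])}"
    and "k \<ge> 2"
  shows "fps_to_fls (F_gf (extend_pat \<tau> k) oo fps_X ^ 2) = R_sqrt k"
proof -
  have "cheb_fps k \<noteq> 0"
    using cheb_fps_nth_0[of k] by auto
  moreover have "fps_to_fls (F_gf (extend_pat \<tau> k) oo fps_X ^ 2) * fps_to_fls (cheb_fps k) =
      fps_to_fls (cheb_fps (k - 1))"
    unfolding F_gf_compose_mult_cheb_fps[OF assms, symmetric]
    by (simp add: fls_times_fps_to_fls)
  ultimately show ?thesis
    using assms(2) by (simp add: R_sqrt_eq eq_divide_eq)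
qed

end
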